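(* Let $D\ge 2$ be an even integer, let $F$ be the field with two elements, and let $V_D$ be a $D$-dimensional symplectic $F$-vector space with a circular basis $e_1,\dots,e_{D+1}$. Let $\phi(V_D)$ be the associated set of collections of odd intervals, with its partial order $\le$, as defined in the context. If $A',A\in\phi(V_D)$ satisfy $A'\le A$, then $|A'|\le|A|$.
   Context: **Setting.** $F$ is the field with two elements, $D\ge2$ is even, and $V_D$ is a $D$-dimensional $F$-vector space with a nondegenerate symplectic form $(\,,):V_D\times V_D\to F$ and a collection of vectors $e_1,e_2,\dots,e_{D+1}$ (a "circular basis") such that $(e_i,e_j)=1$ if $j\equiv i\pm1 \pmod{D+1}$ and $(e_i,e_j)=0$ for all other pairs $i,j$. Such a collection always exists and satisfies $\sum_{i=1}^{D+1}e_i=0$. **Intervals.** For integers $i,j$ write $[i,j]=\{z\in\mathbb Z: i\le z\le j\}$. For $I\subset[1,D+1]$ put $e_I=\sum_{s\in I}e_s\in V_D$. Let $\mathcal I$ be the set of all subsets of $[1,D+1]$ of the form $[i,j]$ or $[1,D+1]-[i,j]$ with $1\le i\le j\le D$ (called intervals). Let $\mathcal I^1$ be the set of $I\in\mathcal I$ with $|I|$ odd. For $I,I'\in\mathcal I^1$: - $I\prec I'$ means $I\subsetneq I'$ and $I'-I=I_1\sqcup I_2$ with $I_1,I_2\in\mathcal I$; - $I\spadesuit I'$ means $I\cap I'=\emptyset$ and $I\cup I'\notin\mathcal I$. For $I\in\mathcal I^1$ let $I^{ev}$ be the set of all $i\in I$ such that $I-\{i\}=I'\sqcup I''$ with $I',I''\in\mathcal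 I^1$ and $I'\spadesuit I''$. **The set $\phi(V_D)$.** It consists of all finite subsets $B\subset\mathcal I^1$ such that: - $(P_0)$ if $I,I'\in B$, then $I=I'$, or $I\spadesuit I'$, or $I\prec I'$, or $I'\prec I$; - $(P_1)$ for every $I\in B$ there exist $I_1,\dots,I_k\in B$ ($k\ge0$), pairwise disjoint, with $I_s\prec I$ for all $s$ and $I^{ev}\subset I_1\cup\dots\cup I_k$. $|B|$ denotes the number of elements of $B$. **The map $\epsilon$ and the order.** For $B\in\phi(V_D)$ let $\langle B\rangle$ be the subspace of $V_D$ spanned by $\{e_I: I\in B\}$. For $i\in[1,D+1]$ let $g_i(B)=|\{I\in B: i\in I\}|$ and let $\epsilon_i(B)\in F$ be the class mod $2$ of $\tfrac12 g_i(B)(g_i(B)+1)$. Put $\epsilon(B)=\sum_{i\in[1,D+1]}\epsilon_i(B)e_i\in V_D$. For $B',B\in\phi(V_D)$, $B'\le B$ means that there exist $B^0,B^1,\dots,B^k\in\phi(V_D)$ with $B^0=B'$, $B^k=B$ and $\epsilon(B^{s-1})\in\langle B^s\rangle$ for $s=1,\dots,k$. **Known facts (from earlier work).** The relation $\le$ is a partial order on $\phi(V_D)$; $\epsilon:\phi(V_D)\to V_D$ is a bijection and $\epsilon(B)\in\langle B\rangle$ for all $B\in\phi(V_D)$; for $B\in\phi(V_D)$ the family $\{e_I: I\in B\}$ is a basis of $\langle B\rangle$, so $|B|=\dim\langle B\rangle$. *)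

theory Defs
  imports Complex_Main "HOL-Library.Z2" "HOL-Library.Disjoint_Sets" "HOL-Number_Theory.Cong"
begin

section \<open>Symplectic spaces over the field with two elements\<close>

text \<open>The space \<open>V\<close> is the whole type \<open>'v\<close>; the field \<open>F\<close> is the type \<^typ>\<open>bit\<close>.
  In characteristic 2 an alternating form is automatically symmetric and skew-symmetric.\<close>

locale symplectic_space = vector_space scale
  for scale :: "bit \<Rightarrow> 'v::ab_group_add \<Rightarrow> 'v" +
  fixes form :: "'v \<Rightarrow> 'v \<Rightarrow> bit"
  assumes linear_left: "Vector_Spaces.linear scale (*) (\<lambda>x. form x y)"
    and linear_right: "Vector_Spaces.linear scale (*) (\<lambda>y. form x y)"
    and alternating: "form x x = 0"
    and nondegenerate: "(\<And>y. form x y = 0) \<Longrightarrow> x = 0"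

text \<open>Only the values \<open>e 1, \<dots>, e (D + 1)\<close> matter. The congruence \<open>j \<equiv> i - 1\<close> is written
  \<open>j + 1 \<equiv> i\<close> to avoid truncated subtraction.\<close>

definition circular_basis :: "nat \<Rightarrow> ('v \<Rightarrow> 'v \<Rightarrow> bit) \<Rightarrow> (nat \<Rightarrow> 'v) \<Rightarrow> bool" where
  "circular_basis D form e \<longleftrightarrow>
     (\<forall>i\<in>{1..D+1}. \<forall>j\<in>{1..D+1}.
        form (e i) (e j) =
          (if [j = i + 1] (mod (D + 1)) \<or> [j + 1 = i] (mod (D + 1)) then 1 else 0))"

section \<open>Intervals\<close>

definition intervals :: "nat \<Rightarrow> nat set set" where
  "intervals D =
     {{i..j} |i j. 1 \<le> i \<and> i \<le> j \<and> j \<le> D} \<union>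
     {{1..D+1} - {i..j} |i j. 1 \<le> i \<and> i \<le> j \<and> j \<le> D}"

definition odd_intervals :: "nat \<Rightarrow> nat set set" where
  "odd_intervals D = {I \<in> intervals D. odd (card I)}"

definition prec :: "nat \<Rightarrow> nat set \<Rightarrow> nat set \<Rightarrow> bool" where
  "prec D I I' \<longleftrightarrow>
     I \<subset> I' \<and>
     (\<exists>I1\<in>intervals D. \<exists>I2\<in>intervals D. I1 \<inter> I2 = {} \<and> I' - I = I1 \<union> I2)"

definition spade :: "nat \<Rightarrow> nat set \<Rightarrow> nat set \<Rightarrow> bool" where
  "spade D I I' \<longleftrightarrow> I \<inter> I' = {} \<and> I \<union> I' \<notin> intervals D"

text \<open>Disjointness of the two parts is included in \<^const>\<open>spade\<close>.\<close>

definition ev_part :: "nat \<Rightarrow> nat set \<Rightarrow> nat set" where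
  "ev_part D I =
     {i \<in> I. \<exists>I'\<in>odd_intervals D. \<exists>I''\<in>odd_intervals D. I - {i} = I' \<union> I'' \<and> spade D I' I''}"

section \<open>The set of collections of odd intervals\<close>

text \<open>In the last clause \<open>C\<close> is the set of the pairwise disjoint \<open>I\<^sub>1, \<dots>, I\<^sub>k\<close>; these are
  automatically distinct, intervals being nonempty.\<close>

definition phi :: "nat \<Rightarrow> nat set set set" where
  "phi D =
     {B. finite B \<and> B \<subseteq> odd_intervals D \<and>
         (\<forall>I\<in>B. \<forall>I'\<in>B. I = I' \<or> spade D I I' \<or> prec D I I' \<or> prec D I' I) \<and>
         (\<forall>I\<in>B. \<exists>C. finite C \<and> C \<subseteq> B \<and> disjoint C \<and> (\<forall>J\<in>C. prec D J I) \<and> ev_part D I \<subseteq> \<Union>C)}"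

section \<open>The map \<open>\<epsilon>\<close> and the order\<close>

definition e_set :: "(nat \<Rightarrow> 'v::ab_group_add) \<Rightarrow> nat set \<Rightarrow> 'v" where
  "e_set e I = (\<Sum>s\<in>I. e s)"

definition span_coll ::
  "(bit \<Rightarrow> 'v::ab_group_add \<Rightarrow> 'v) \<Rightarrow> (nat \<Rightarrow> 'v) \<Rightarrow> nat set set \<Rightarrow> 'v set" where
  "span_coll scale e B = module.span scale (e_set e ` B)"

definition g_count :: "nat set set \<Rightarrow> nat \<Rightarrow> nat" where
  "g_count B i = card {I \<in> B. i \<in> I}"

definition eps_coeff :: "nat set set \<Rightarrow> nat \<Rightarrow> bit" where
  "eps_coeff B i = of_nat (g_count B i * (g_count B i + 1) div 2)"

definition eps ::
  "nat \<Rightarrow> (bit \<Rightarrow> 'v::ab_group_add \<Rightarrow> 'v) \<Rightarrow> (nat \<Rightarrow> 'v) \<Rightarrow> nat set set \<Rightarrow> 'v" where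
  "eps D scale e B = (\<Sum>i\<in>{1..D+1}. scale (eps_coeff B i) (e i))"

definition phi_le ::
  "nat \<Rightarrow> (bit \<Rightarrow> 'v::ab_group_add \<Rightarrow> 'v) \<Rightarrow> (nat \<Rightarrow> 'v) \<Rightarrow> nat set set \<Rightarrow> nat set set \<Rightarrow> bool" where
  "phi_le D scale e B' B \<longleftrightarrow>
     (\<exists>k. \<exists>Bs :: nat \<Rightarrow> nat set set.
        (\<forall>s\<le>k. Bs s \<in> phi D) \<and> Bs 0 = B' \<and> Bs k = B \<and>
        (\<forall>s\<in>{1..k}. eps D scale e (Bs (s - 1)) \<in> span_coll scale e (Bs s)))"

end

theory Submission
  imports Defs
begin

text \<open>
  The points \<open>1, \<dots>, D + 1\<close> lie on a cycle of odd length. For \<open>B \<in> \<phi>(V\<^sub>D)\<close> each edge of the cycle is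
  separated by at most one member of \<open>B\<close>, and if by none, then both its ends are uncovered. Each member
  separates two edges, so \<open>2|B|\<close> is the number of edges with a covered end, and it suffices
  that \<open>\<epsilon>(B') \<in> \<langle>B\<rangle>\<close> implies \<open>\<Union>B' \<subseteq> \<Union>B\<close>.

  A vector \<open>\<Sum>x\<^sub>i e\<^sub>i\<close> determines the coefficients \<open>x\<^sub>i\<close> up to a common constant, hence the edges along which
  they change. Since the cycle is odd, there is at most one function \<open>M\<close> on the points whose sum over the two ends
  of an edge is \<open>-2\<close> on those edges and \<open>2\<close> on the others. For \<open>\<epsilon>(B')\<close> it is
  \<open>M = (-1)\<^sup>g (2g + 1)\<close> with \<open>g = g\<^sub>i(B')\<close>. For a sum of \<open>e\<^sub>I\<close> with \<open>I\<close> in a subset of \<open>B\<close> it is \<open>1\<close> plus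
  contributions \<open>\<plusminus>4\<close> alternating along each such \<open>I\<close> and vanishing outside, so \<open>M = 1\<close> off \<open>\<Union>B\<close>.
  If both describe the same vector, then \<open>g\<^sub>i(B') = 0\<close> for \<open>i \<notin> \<Union>B\<close>.
\<close>

section \<open>Positions and arcs on the cycle\<close>

definition succ_pt :: "nat \<Rightarrow> nat \<Rightarrow> nat" where
  "succ_pt D i = (if i = D + 1 then 1 else i + 1)"

text \<open>The number of steps from \<open>a\<close> to \<open>x\<close> along the cycle \<open>1, \<dots>, D + 1\<close>, so that
  \<open>arc D a n\<close> is the cyclic interval of length \<open>n\<close> starting at \<open>a\<close>.\<close>

definition pos :: "nat \<Rightarrow> nat \<Rightarrow> nat \<Rightarrow> nat" where
  "pos D a x = (if a \<le> x then x - a else x + (D + 1) - a)"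

definition arc :: "nat \<Rightarrow> nat \<Rightarrow> nat \<Rightarrow> nat set" where
  "arc D a n = {x \<in> {1..D+1}. pos D a x < n}"

text \<open>The index \<open>i\<close> stands for the edge of the cycle from \<open>i\<close> to its successor.\<close>

definition separates :: "nat \<Rightarrow> nat set \<Rightarrow> nat \<Rightarrow> bool" where
  "separates D I i \<longleftrightarrow> (i \<in> I) \<noteq> (succ_pt D i \<in> I)"

lemma succ_pt_in: "i \<in> {1..D+1} \<Longrightarrow> succ_pt D i \<in> {1..D+1}"
  by (auto simp: succ_pt_def)

lemma pos_less: "a \<in> {1..D+1} \<Longrightarrow> x \<in> {1..D+1} \<Longrightarrow> pos D a x \<le> D"
  by (auto simp: pos_def)

lemma pos_self: "pos D a a = 0"
  by (simp add: pos_def)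

lemma pos_succ:
  assumes "a \<in> {1..D+1}" "x \<in> {1..D+1}"
  shows "pos D a (succ_pt D x) = (if pos D a x = D then 0 else pos D a x + 1)"
  using assms by (auto simp: pos_def succ_pt_def)

lemma pos_inj:
  assumes "a \<in> {1..D+1}" "x \<in> {1..D+1}" "y \<in> {1..D+1}" "pos D a x = pos D a y"
  shows "x = y"
  using assms by (auto simp: pos_def split: if_splits)

lemma pos_surj:
  assumes "a \<in> {1..D+1}" "k \<le> D"
  shows "\<exists>x\<in>{1..D+1}. pos D a x = k"
proof (cases "a + k \<le> D + 1")
  case True
  then show ?thesis using assms by (intro bexI[of _ "a + k"]) (auto simp: pos_def)
next
  case False
  then show ?thesis using assms by (intro bexI[of _ "a + k - (D + 1)"]) (auto simp: pos_def)
qed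

lemma pos_rebase:
  assumes "a \<in> {1..D+1}" "b \<in> {1..D+1}" "x \<in> {1..D+1}"
  shows "pos D b x = (if pos D a b \<le> pos D a x then pos D a x - pos D a b
    else pos D a x + (D + 1) - pos D a b)"
  using assms by (auto simp: pos_def)

lemma card_arc:
  assumes "a \<in> {1..D+1}" "n \<le> D + 1"
  shows "card (arc D a n) = n"
proof -
  have "bij_betw (pos D a) (arc D a n) {..<n}"
    unfolding bij_betw_def
  proof
    show "inj_on (pos D a) (arc D a n)"
      using pos_inj[OF assms(1)] by (auto simp: inj_on_def arc_def)
    show "pos D a ` arc D a n = {..<n}"
    proof (intro equalityI subsetI)
      fix k assume "k \<in> {..<n}"
      then obtain x where "x \<in> {1..D+1}" "pos D a x = k"
        using pos_surj[OF assms(1), of k] assms(2) by auto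
      then show "k \<in> pos D a ` arc D a n" using \<open>k \<in> _\<close> by (auto simp: arc_def)
    qed (auto simp: arc_def)
  qed
  then show ?thesis by (simp add: bij_betw_same_card)
qed

lemma arc_in_intervals:
  assumes "a \<in> {1..D+1}" "1 \<le> n" "n \<le> D"
  shows "arc D a n \<in> intervals D"
proof (cases "a + n \<le> D + 1")
  case True
  then have "arc D a n = {a..a + n - 1}"
    using assms by (auto simp: arc_def pos_def split: if_splits)
  moreover have "1 \<le> a \<and> a \<le> a + n - 1 \<and> a + n - 1 \<le> D" using True assms by auto
  ultimately show ?thesis unfolding intervals_def by blast
next
  case False
  then have "arc D a n = {1..D+1} - {a + n - (D + 1)..a - 1}"
    using assms by (auto simp: arc_def pos_def split: if_splits)
  moreover have "1 \<le> a + n - (D + 1) \<and> a + n - (D + 1) \<le> a - 1 \<and> a - 1 \<le> D"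
    using False assms by auto
  ultimately show ?thesis unfolding intervals_def by blast
qed

lemma intervals_cases:
  assumes "I \<in> intervals D"
  obtains a n where "a \<in> {1..D+1}" "1 \<le> n" "n \<le> D" "I = arc D a n"
proof -
  from assms consider (inner) i j where "1 \<le> i" "i \<le> j" "j \<le> D" "I = {i..j}"
    | (outer) i j where "1 \<le> i" "i \<le> j" "j \<le> D" "I = {1..D+1} - {i..j}"
    unfolding intervals_def by blast
  then show ?thesis
  proof cases
    case inner
    then show ?thesis
      by (intro that[of i "j - i + 1"]) (auto simp: arc_def pos_def split: if_splits)
  next
    case outer
    then show ?thesis
      by (intro that[of "j + 1" "D + 1 - (j - i + 1)"]) (auto simp: arc_def pos_def split: if_splits)
  qed
qed

lemma odd_intervals_cases:
  assumes "I \<in> odd_intervals D"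
  obtains a n where "a \<in> {1..D+1}" "odd n" "n \<le> D" "I = arc D a n"
proof -
  from assms have "I \<in> intervals D" "odd (card I)" by (auto simp: odd_intervals_def)
  then show ?thesis by (elim intervals_cases) (auto simp: card_arc intro: that)
qed

lemma arc_in_odd_intervals:
  assumes "a \<in> {1..D+1}" "odd n" "n \<le> D"
  shows "arc D a n \<in> odd_intervals D"
  using assms by (auto simp: odd_intervals_def card_arc arc_in_intervals odd_pos Suc_leI)

section \<open>Boundary edges of arcs and the set \<open>ev_part\<close>\<close>

lemma arc_entry:
  assumes "a \<in> {1..D+1}" "i \<in> {1..D+1}" "i \<notin> arc D a n" "succ_pt D i \<in> arc D a n"
  shows "succ_pt D i = a"
proof -
  have "pos D a (succ_pt D i) = pos D a a"
    using assms pos_succ[of a D i] by (auto simp: arc_def pos_self split: if_splits)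
  then show ?thesis using assms pos_inj succ_pt_in by blast
qed

lemma arc_exit:
  assumes "a \<in> {1..D+1}" "i \<in> {1..D+1}" "i \<in> arc D a n" "succ_pt D i \<notin> arc D a n"
  shows "pos D a i + 1 = n"
  using assms pos_succ[of a D i] succ_pt_in[of i D] by (auto simp: arc_def split: if_splits)

text \<open>The bound keeps the arc from wrapping past \<open>a\<close>, so its positions counted
  from \<open>a\<close> form one block.\<close>

lemma arc_split:
  assumes "a \<in> {1..D+1}" "b \<in> {1..D+1}" "pos D a b + m \<le> D + 1"
  shows "arc D b m = {x \<in> {1..D+1}. pos D a b \<le> pos D a x \<and> pos D a x < pos D a b + m}"
proof -
  have "pos D b x < m \<longleftrightarrow> pos D a b \<le> pos D a x \<and> pos D a x < pos D a b + m"
    if "x \<in> {1..D+1}" for x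
    using pos_rebase[OF assms(1,2) that] pos_less[OF assms(1) that] assms(3)
    by (simp split: if_splits; linarith)
  then show ?thesis by (auto simp: arc_def)
qed

text \<open>Positions count from 0, so removing a point at an odd position leaves two arcs of odd
  length. They are not adjacent: \<open>x\<close> lies between them on one side and, since
  \<open>n \<le> D\<close>, a point outside the arc on the other.\<close>

lemma odd_pos_in_ev_part:
  assumes a: "a \<in> {1..D+1}" and n: "odd n" "n \<le> D"
    and x: "x \<in> {1..D+1}" "odd (pos D a x)" "pos D a x < n"
  shows "x \<in> ev_part D (arc D a n)"
proof -
  let ?p = "pos D a x" and ?b = "succ_pt D x"
  have p: "?p + 1 < n" using n x by (metis even_Suc Suc_eq_plus1 Suc_lessI)
  have b: "?b \<in> {1..D+1}" using x succ_pt_in by blast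
  have pb: "pos D a ?b = ?p + 1" using pos_succ[OF a x(1)] p n by auto
  define R where "R = arc D ?b (n - (?p + 1))"
  have R: "R = {y \<in> {1..D+1}. ?p + 1 \<le> pos D a y \<and> pos D a y < n}"
    unfolding R_def using arc_split[OF a b, of "n - (?p + 1)"] pb p n by simp
  have "R \<in> odd_intervals D"
    unfolding R_def using n x p by (intro arc_in_odd_intervals b) auto
  moreover have "arc D a ?p \<in> odd_intervals D"
    using n x p by (intro arc_in_odd_intervals a) auto
  moreover have eq: "arc D a n - {x} = arc D a ?p \<union> R"
    using pos_inj[OF a _ x(1)] p x unfolding R by (fastforce simp: arc_def)
  moreover have "arc D a ?p \<inter> R = {}" unfolding R by (auto simp: arc_def)
  \<comment> \<open>A cyclic interval is entered along one edge only, but this set is entered both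
    at \<open>a\<close>, from the preceding point \<open>z\<close>, and at the successor of
    \<open>x\<close>.\<close>
  moreover have "arc D a n - {x} \<notin> intervals D"
  proof
    assume "arc D a n - {x} \<in> intervals D"
    then obtain c m where c: "c \<in> {1..D+1}" "arc D a n - {x} = arc D c m"
      by (elim intervals_cases) blast
    obtain z where z: "z \<in> {1..D+1}" "pos D a z = D" using pos_surj[OF a, of D] by blast
    have za: "succ_pt D z = a"
      using pos_succ[OF a z(1)] z a pos_self[of D a] by (metis pos_inj succ_pt_in)
    have "succ_pt D z \<in> arc D c m"
      unfolding za c(2)[symmetric] using a p x by (auto simp: arc_def pos_self)
    moreover have "z \<notin> arc D c m"
      unfolding c(2)[symmetric] using z n by (auto simp: arc_def)
    ultimately have "c = a" using arc_entry[OF c(1) z(1)] za by blast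
    moreover have "?b \<in> arc D c m"
      unfolding c(2)[symmetric] using b pb p by (auto simp: arc_def)
    moreover have "x \<notin> arc D c m" unfolding c(2)[symmetric] by blast
    ultimately have "?b = a" using arc_entry[OF c(1) x(1)] by blast
    then show False using pb pos_self[of D a] by simp
  qed
  ultimately have "spade D (arc D a ?p) R" by (simp add: spade_def)
  then show ?thesis
    unfolding ev_part_def using x eq \<open>R \<in> _\<close> \<open>arc D a ?p \<in> _\<close> by (auto simp: arc_def)
qed

section \<open>Adjacency of odd intervals\<close>

lemma odd_interval_subset: "I \<in> odd_intervals D \<Longrightarrow> I \<subseteq> {1..D+1}"
  by (elim odd_intervals_cases) (auto simp: arc_def)

lemma odd_interval_finite: "I \<in> odd_intervals D \<Longrightarrow> finite I"
  using odd_interval_subset finite_subset by blast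

lemma adjacent_union_interval:
  assumes "even D" "I \<in> odd_intervals D" "J \<in> odd_intervals D"
    and i: "i \<in> {1..D+1}" "i \<in> I" "succ_pt D i \<in> J" and disj: "I \<inter> J = {}"
  shows "I \<union> J \<in> intervals D"
proof -
  obtain a n where a: "a \<in> {1..D+1}" and n: "odd n" "n \<le> D" and I: "I = arc D a n"
    using assms(2) by (elim odd_intervals_cases)
  obtain b m where b: "b \<in> {1..D+1}" and m: "odd m" "m \<le> D" and J: "J = arc D b m"
    using assms(3) by (elim odd_intervals_cases)
  have "i \<notin> J" "succ_pt D i \<notin> I" using i disj by auto
  then have ends: "succ_pt D i = b" "pos D a i + 1 = n"
    using arc_entry[OF b i(1)] arc_exit[OF a i(1)] i(2,3) I J by simp_all
  have pb: "pos D a b = n"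
    using pos_succ[OF a i(1)] n ends by auto
  have "card (I \<union> J) = card I + card J"
    using disj assms(2,3) odd_interval_finite by (intro card_Un_disjoint) auto
  also have "\<dots> = n + m" using a b n m I J by (simp add: card_arc)
  finally have "n + m = card (I \<union> J)" by simp
  also have "\<dots> \<le> card {1..D+1}"
    using odd_interval_subset[OF assms(2)] odd_interval_subset[OF assms(3)]
    by (intro card_mono) auto
  finally have "n + m \<le> D + 1" by simp
  \<comment> \<open>Parity prevents the two arcs from filling the whole cycle, which has odd length
    and is not an interval.\<close>
  moreover have "even (n + m)" using n m by simp
  then have "n + m \<noteq> D + 1" using assms(1) by (metis even_add odd_one)
  ultimately have nm: "n + m \<le> D" by simp
  have J': "J = {x \<in> {1..D+1}. n \<le> pos D a x \<and> pos D a x < n + m}"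
    using arc_split[OF a b, of m] nm unfolding J pb by simp
  have "I \<union> J = arc D a (n + m)"
    unfolding I J' arc_def by auto
  then show ?thesis using arc_in_intervals[OF a, of "n + m"] nm n(1) odd_pos[of n] by simp
qed

lemma spade_not_adjacent:
  assumes "even D" "I \<in> odd_intervals D" "J \<in> odd_intervals D" "spade D I J" "i \<in> {1..D+1}"
  shows "\<not> (i \<in> I \<and> succ_pt D i \<in> J)" "\<not> (i \<in> J \<and> succ_pt D i \<in> I)"
proof -
  have "I \<inter> J = {}" "J \<inter> I = {}" "I \<union> J \<notin> intervals D" "J \<union> I \<notin> intervals D"
    using assms(4) by (simp_all add: spade_def Un_commute Int_commute)
  then show "\<not> (i \<in> I \<and> succ_pt D i \<in> J)" "\<not> (i \<in> J \<and> succ_pt D i \<in> I)"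
    using adjacent_union_interval[OF assms(1-3,5)] adjacent_union_interval[OF assms(1,3,2,5)]
    by metis+
qed

section \<open>Edges separated by the members of a collection\<close>

lemma phi_odd: "B \<in> phi D \<Longrightarrow> I \<in> B \<Longrightarrow> I \<in> odd_intervals D"
  by (auto simp: phi_def)

lemma phi_finite: "B \<in> phi D \<Longrightarrow> finite B"
  by (auto simp: phi_def)

lemma phi_compat:
  assumes "B \<in> phi D" "I \<in> B" "J \<in> B"
  shows "spade D I J \<or> I \<subseteq> J \<or> J \<subseteq> I"
proof -
  have "I = J \<or> spade D I J \<or> prec D I J \<or> prec D J I"
    using assms unfolding phi_def by blast
  then show ?thesis unfolding prec_def by blast
qed

lemma phi_ev_covered:
  assumes "B \<in> phi D" "I \<in> B" "x \<in> ev_part D I"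
  obtains J where "J \<in> B" "J \<subset> I" "x \<in> J"
proof -
  have "\<forall>I\<in>B. \<exists>C. finite C \<and> C \<subseteq> B \<and> disjoint C \<and> (\<forall>J\<in>C. prec D J I) \<and> ev_part D I \<subseteq> \<Union>C"
    using assms(1) unfolding phi_def mem_Collect_eq by (elim conjE) assumption
  from bspec[OF this assms(2)] obtain C
    where C: "C \<subseteq> B" "\<forall>J\<in>C. prec D J I" "ev_part D I \<subseteq> \<Union>C"
    by metis
  then obtain J where J: "J \<in> C" "x \<in> J" using assms(3) by blast
  then have "J \<subset> I" using C(2) unfolding prec_def by blast
  then show ?thesis using that C(1) J by blast
qed

text \<open>With one end shared, \<open>J - I\<close> is an arc of even length beyond the other end
  of \<open>I\<close>. Its point \<open>d\<close> next to \<open>I\<close> therefore has an odd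
  position in \<open>J\<close>. The edge \<open>c\<close> joins \<open>d\<close> to
  \<open>I\<close>, and its direction depends on which end is shared.\<close>

lemma shared_end_ev_part:
  assumes "I \<in> odd_intervals D" "J \<in> odd_intervals D" "I \<subset> J"
    and i: "i \<in> {1..D+1}" and sep: "separates D I i" "separates D J i"
  obtains c d where "d \<in> ev_part D J" "d \<notin> I" "c \<in> {1..D+1}"
    "c = d \<and> succ_pt D c \<in> I \<or> c \<in> I \<and> succ_pt D c = d"
proof -
  obtain a n where a: "a \<in> {1..D+1}" and n: "odd n" "n \<le> D" and I: "I = arc D a n"
    using assms(1) by (elim odd_intervals_cases)
  obtain b m where b: "b \<in> {1..D+1}" and m: "odd m" "m \<le> D" and J: "J = arc D b m"
    using assms(2) by (elim odd_intervals_cases)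
  have nm: "n < m"
    using psubset_card_mono[OF odd_interval_finite[OF assms(2)] assms(3)] a n b m I J
    by (simp add: card_arc)
  have n0: "0 < n" using n by (simp add: odd_pos)
  show ?thesis
  proof (cases "i \<in> I")
    case True
    then have "succ_pt D i \<notin> I" "i \<in> J" "succ_pt D i \<notin> J"
      using sep assms(3) by (auto simp: separates_def)
    then have ends: "pos D a i + 1 = n" "pos D b i + 1 = m"
      using arc_exit[OF a i] arc_exit[OF b i] True I J by simp_all
    then have pa: "pos D b a = m - n"
      using pos_rebase[OF b a i] pos_less[OF b a] nm m(2) by (simp split: if_splits; linarith)
    have "m - n - 1 \<le> D" using m(2) by simp
    then obtain d where d: "d \<in> {1..D+1}" "pos D b d = m - n - 1"
      using pos_surj[OF b] by blast
    have "odd (m - n - 1)" "m - n - 1 < m" using n m nm by auto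
    then have "d \<in> ev_part D J"
      unfolding J using odd_pos_in_ev_part[OF b m d(1)] d(2) by simp
    moreover have "pos D b (succ_pt D d) = pos D b a"
      unfolding pos_succ[OF b d(1)] d(2) pa using nm m(2) n0 by auto
    then have "succ_pt D d = a" using pos_inj[OF b succ_pt_in[OF d(1)] a] by blast
    moreover have "pos D a d = D"
      using pos_rebase[OF b a d(1)] nm m(2) n0 unfolding pa d(2) by auto
    then have "d \<notin> I" using n nm m unfolding I arc_def by simp
    moreover have "a \<in> I" unfolding I arc_def using a n0 by (simp add: pos_self)
    ultimately show ?thesis using that d(1) by blast
  next
    case False
    then have "succ_pt D i \<in> I" "i \<notin> J" "succ_pt D i \<in> J"
      using sep assms(3) by (auto simp: separates_def)
    then have ab: "a = b"
      using False arc_entry[OF a i] arc_entry[OF b i] I J by metis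
    obtain d where d: "d \<in> {1..D+1}" "pos D a d = n" using pos_surj[OF a n(2)] by blast
    have "n - 1 \<le> D" using n(2) by simp
    then obtain c where c: "c \<in> {1..D+1}" "pos D a c = n - 1" using pos_surj[OF a] by blast
    have "pos D a (succ_pt D c) = pos D a d"
      unfolding pos_succ[OF a c(1)] c(2) d(2) using n n0 by simp
    then have "succ_pt D c = d" using pos_inj[OF a succ_pt_in[OF c(1)] d(1)] by blast
    moreover have "d \<in> ev_part D J"
      unfolding J using odd_pos_in_ev_part[OF b m d(1)] d(2) n(1) nm ab by simp
    moreover have "d \<notin> I" "c \<in> I" unfolding I arc_def using c d n0 by simp_all
    ultimately show ?thesis using that c(1) by blast
  qed
qed

text \<open>The relation \<^const>\<open>prec\<close> alone allows \<open>I\<close> and \<open>J\<close> to share an end point, as the difference may be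
  one interval cut in two. The covering condition \<open>(P\<^sub>1)\<close> excludes this: the point of \<open>J\<close> next to the
  other end of \<open>I\<close> is covered by a member of the collection, which lies strictly between \<open>I\<close> and \<open>J\<close>.\<close>

lemma phi_no_shared_end:
  assumes "even D" "B \<in> phi D" "I \<in> B" and i: "i \<in> {1..D+1}" "separates D I i"
  shows "J \<in> B \<Longrightarrow> I \<subset> J \<Longrightarrow> \<not> separates D J i"
proof (induction "card J" arbitrary: J rule: less_induct)
  case less
  have I: "I \<in> odd_intervals D" and J: "J \<in> odd_intervals D"
    using phi_odd[OF assms(2)] assms(3) less.prems(1) by blast+
  show ?case
  proof
    assume sep: "separates D J i"
    obtain c d where d: "d \<in> ev_part D J" "d \<notin> I"
      and c: "c \<in> {1..D+1}" "c = d \<and> succ_pt D c \<in> I \<or> c \<in> I \<and> succ_pt D c = d"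
      by (rule shared_end_ev_part[OF I J less.prems(2) i sep])
    obtain K where K: "K \<in> B" "K \<subset> J" "d \<in> K"
      by (rule phi_ev_covered[OF assms(2) less.prems(1) d(1)])
    have "\<not> spade D I K"
      using spade_not_adjacent[OF assms(1) I phi_odd[OF assms(2) K(1)] _ c(1)] c(2) K(3) by auto
    then have "I \<subset> K" using phi_compat[OF assms(2,3) K(1)] K(3) d(2) by blast
    \<comment> \<open>One end of the edge lies in \<open>I\<close>, hence in \<open>K\<close>; the
      other lies outside \<open>J\<close>, hence outside \<open>K\<close>.\<close>
    moreover have "separates D K i"
      using sep i(2) \<open>I \<subset> K\<close> K(2) unfolding separates_def by blast
    moreover have "card K < card J"
      using K(2) odd_interval_finite[OF J] by (simp add: psubset_card_mono)
    ultimately show False using less.hyps[OF _ K(1)] by simp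
  qed
qed

text \<open>Disjoint members would contain opposite ends of the edge and so be adjacent, which
  \<open>spade\<close> forbids; nested ones would share an end.\<close>

lemma phi_separates_unique:
  assumes "even D" "B \<in> phi D" "I \<in> B" "J \<in> B" "i \<in> {1..D+1}"
    and "separates D I i" "separates D J i"
  shows "I = J"
proof (rule ccontr)
  assume "I \<noteq> J"
  have "\<not> spade D I J"
    using spade_not_adjacent[OF assms(1) phi_odd[OF assms(2,3)] phi_odd[OF assms(2,4)] _ assms(5)]
      assms(6,7) by (auto simp: separates_def spade_def)
  then have "I \<subset> J \<or> J \<subset> I" using phi_compat[OF assms(2-4)] \<open>I \<noteq> J\<close> by blast
  then show False using phi_no_shared_end[OF assms(1,2)] assms by blast
qed

text \<open>Descent on a member containing both ends: one of two consecutive positions is odd, so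
  that end is covered by a strictly smaller member, which again contains both ends because it does
  not separate them.\<close>

lemma phi_not_separated:
  assumes "B \<in> phi D" "i \<in> {1..D+1}" "\<And>I. I \<in> B \<Longrightarrow> \<not> separates D I i"
  shows "i \<notin> \<Union>B" "succ_pt D i \<notin> \<Union>B"
proof -
  have False if "I \<in> B" "i \<in> I" "succ_pt D i \<in> I" for I
    using that
  proof (induction "card I" arbitrary: I rule: less_induct)
    case less
    have I: "I \<in> odd_intervals D" using assms less phi_odd by blast
    obtain a n where a: "a \<in> {1..D+1}" "odd n" "n \<le> D" "I = arc D a n"
      using I by (elim odd_intervals_cases)
    have "i \<in> ev_part D I \<or> succ_pt D i \<in> ev_part D I"
    proof (cases "odd (pos D a i)")
      case True
      then show ?thesis
        using odd_pos_in_ev_part[OF a(1-3) assms(2)] less a by (auto simp: arc_def)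
    next
      case False
      have "pos D a i < n" "pos D a (succ_pt D i) < n" using less a by (auto simp: arc_def)
      moreover have "odd (pos D a (succ_pt D i))"
        using pos_succ[OF a(1) assms(2)] calculation False a by (auto split: if_splits)
      ultimately show ?thesis
        using odd_pos_in_ev_part[OF a(1-3) succ_pt_in[OF assms(2)]] a by auto
    qed
    then obtain J where J: "J \<in> B" "J \<subset> I" "i \<in> J \<or> succ_pt D i \<in> J"
      using phi_ev_covered[OF assms(1) less.prems(1)] by metis
    then have "i \<in> J" "succ_pt D i \<in> J" using assms(3) by (auto simp: separates_def)
    then show False
      using less.hyps[of J] J psubset_card_mono[OF odd_interval_finite[OF I]] by blast
  qed
  then show "i \<notin> \<Union>B" "succ_pt D i \<notin> \<Union>B" using assms(3) by (auto simp: separates_def)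
qed

section \<open>Edge sums on the odd cycle\<close>

lemma card_separated:
  assumes "I \<in> odd_intervals D"
  shows "card {i \<in> {1..D+1}. separates D I i} = 2"
proof -
  obtain a n where a: "a \<in> {1..D+1}" and n: "odd n" "n \<le> D" and I: "I = arc D a n"
    using assms by (elim odd_intervals_cases)
  have n0: "0 < n" using n by (simp add: odd_pos)
  \<comment> \<open>The separated edges are those leaving \<open>z\<close>, the point just before
    the arc, and \<open>w\<close>, its last point.\<close>
  obtain z where z: "z \<in> {1..D+1}" "pos D a z = D" using pos_surj[OF a] by blast
  have "n - 1 \<le> D" using n by simp
  then obtain w where w: "w \<in> {1..D+1}" "pos D a w = n - 1" using pos_surj[OF a] by blast
  have "separates D I i \<longleftrightarrow> i = z \<or> i = w" if i: "i \<in> {1..D+1}" for i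
  proof -
    have "separates D I i \<longleftrightarrow> pos D a i = D \<or> pos D a i = n - 1"
      using pos_succ[OF a i] pos_less[OF a i] i succ_pt_in[OF i] n(2) n0
      unfolding separates_def I arc_def by auto
    then show ?thesis using pos_inj[OF a i] z w by metis
  qed
  then have "{i \<in> {1..D+1}. separates D I i} = {z, w}" using z(1) w(1) by auto
  moreover have "z \<noteq> w" using z(2) w(2) n(2) n0 by auto
  ultimately show ?thesis by simp
qed

text \<open>The values -1, 1, -1, ... along the arc cancel on inner edges. As the length is odd,
  both end points carry -1, which gives the same sum on the two boundary edges.\<close>

lemma odd_interval_potential:
  assumes "I \<in> odd_intervals D"
  shows "\<exists>\<beta> :: nat \<Rightarrow> int.
    (\<forall>i\<in>{1..D+1}. \<beta> i + \<beta> (succ_pt D i) = - of_bool (separates D I i)) \<and>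
    (\<forall>i. i \<notin> I \<longrightarrow> \<beta> i = 0)"
proof -
  obtain a n where a: "a \<in> {1..D+1}" and n: "odd n" "n \<le> D" and I: "I = arc D a n"
    using assms by (elim odd_intervals_cases)
  define \<beta> :: "nat \<Rightarrow> int" where "\<beta> i = (if i \<in> I then - ((-1) ^ pos D a i) else 0)" for i
  have "\<beta> i + \<beta> (succ_pt D i) = - of_bool (separates D I i)" if i: "i \<in> {1..D+1}" for i
  proof -
    have mem: "j \<in> I \<longleftrightarrow> pos D a j < n" if "j \<in> {1..D+1}" for j
      using that unfolding I arc_def by simp
    consider "pos D a i = D" | "pos D a i < D" "pos D a i + 1 < n" | "pos D a i < D" "pos D a i + 1 = n"
      | "pos D a i < D" "n < pos D a i + 1"
      using pos_less[OF a i] by linarith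
    then show ?thesis
    proof cases
      case 3
      then have "even (pos D a i)" using n(1) by auto
      then show ?thesis
        using 3 pos_succ[OF a i] by (simp add: \<beta>_def separates_def mem[OF i] mem[OF succ_pt_in[OF i]])
    qed (use n odd_pos[OF n(1)] in
      \<open>auto simp: \<beta>_def separates_def mem[OF i] mem[OF succ_pt_in[OF i]] pos_succ[OF a i]\<close>)
  qed
  then show ?thesis by (intro exI[of _ \<beta>]) (simp add: \<beta>_def)
qed

text \<open>The values alternate in sign from 1 to \<open>D + 1\<close>, so the first and last agree
  as \<open>D\<close> is even; the closing edge makes them cancel. Applied to a difference, this
  gives uniqueness of a function with prescribed edge sums.\<close>

lemma odd_cycle_zero:
  fixes f :: "nat \<Rightarrow> int"
  assumes "even D" and f: "\<And>i. i \<in> {1..D+1} \<Longrightarrow> f i + f (succ_pt D i) = 0"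
    and "i \<in> {1..D+1}"
  shows "f i = 0"
proof -
  have step: "f (k + 1) = (-1) ^ k * f 1" if "k \<le> D" for k
    using that
  proof (induction k)
    case (Suc k)
    then show ?case using f[of "k + 1"] by (simp add: succ_pt_def)
  qed simp
  have "f (D + 1) = f 1" using step[of D] assms(1) by simp
  then have "f 1 = 0" using f[of "D + 1"] by (simp add: succ_pt_def)
  moreover have "i - 1 \<le> D" "i - 1 + 1 = i" using assms(3) by auto
  ultimately show ?thesis using step[of "i - 1"] by simp
qed

section \<open>Covering counts and signed heights\<close>

text \<open>Uniqueness is a hypothesis so that the rule also serves subsets of a collection, which
  may fail to lie in \<open>phi D\<close>.\<close>

lemma g_count_step:
  assumes "finite B" and i: "i \<in> {1..D+1}"
    and uniq: "\<And>I J. \<lbrakk>I \<in> B; J \<in> B; separates D I i; separates D J i\<rbrakk> \<Longrightarrow> I = J"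
  obtains (none) "{I \<in> B. separates D I i} = {}" "g_count B (succ_pt D i) = g_count B i"
    | (one) I where "{I \<in> B. separates D I i} = {I}"
        "g_count B (succ_pt D i) = g_count B i + 1 \<or> g_count B i = g_count B (succ_pt D i) + 1"
proof (cases "{I \<in> B. separates D I i} = {}")
  case True
  then have "{I \<in> B. i \<in> I} = {I \<in> B. succ_pt D i \<in> I}" by (auto simp: separates_def)
  then show ?thesis using none True by (simp add: g_count_def)
next
  case False
  then obtain I where I: "I \<in> B" "separates D I i" by blast
  let ?X = "{J \<in> B. i \<in> J}" and ?Y = "{J \<in> B. succ_pt D i \<in> J}"
  have other: "i \<in> J \<longleftrightarrow> succ_pt D i \<in> J" if "J \<in> B" "J \<noteq> I" for J
    using uniq[OF that(1) I(1) _ I(2)] that(2) by (auto simp: separates_def)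
  have fin: "finite ?X" "finite ?Y" using assms(1) by simp_all
  have "card ?Y = card ?X + 1 \<or> card ?X = card ?Y + 1"
  proof (cases "i \<in> I")
    case True
    then have "succ_pt D i \<notin> I" using I(2) by (simp add: separates_def)
    then have "?X = insert I ?Y" "I \<notin> ?Y" using True other I(1) by auto
    then show ?thesis using fin by simp
  next
    case False
    then have "succ_pt D i \<in> I" using I(2) by (simp add: separates_def)
    then have "?Y = insert I ?X" "I \<notin> ?X" using False other I(1) by auto
    then show ?thesis using fin by simp
  qed
  moreover have "{J \<in> B. separates D J i} = {I}" using uniq I by blast
  ultimately show ?thesis using one by (simp add: g_count_def)
qed

text \<open>Along an edge the count \<open>g\<close> changes by one or stays at \<open>0\<close>, so the sums of this function over the
  two ends of each edge determine, and are determined by, the edges where \<^const>\<open>eps_coeff\<close> changes.\<close>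

definition height_sign :: "nat \<Rightarrow> int" where
  "height_sign g = (-1) ^ g * (2 * int g + 1)"

lemma of_nat_bit_eq_0_iff: "(of_nat n :: bit) = 0 \<longleftrightarrow> even n"
  by (induction n) (auto simp del: bit_not_zero_iff)

text \<open>Consecutive triangular numbers here differ by \<open>g + 1\<close>.\<close>

lemma triangular_step:
  "(of_nat (g * (g + 1) div 2) :: bit) = of_nat ((g + 1) * (g + 2) div 2) \<longleftrightarrow> odd g"
proof -
  have "(g + 1) * (g + 2) div 2 = (g * (g + 1) + (g + 1) * 2) div 2" by (simp add: algebra_simps)
  also have "\<dots> = g * (g + 1) div 2 + (g + 1)" by simp
  finally have eq: "(g + 1) * (g + 2) div 2 = g * (g + 1) div 2 + (g + 1)" .
  show ?thesis
    unfolding eq of_nat_add[of "g * (g + 1) div 2"]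
    by (simp only: add_cancel_right_right of_nat_bit_eq_0_iff) simp
qed

lemma height_sign_step:
  "height_sign g + height_sign (g + 1) =
    (if (of_nat (g * (g + 1) div 2) :: bit) = of_nat ((g + 1) * (g + 2) div 2) then 2 else - 2)"
  unfolding triangular_step by (auto simp: height_sign_def algebra_simps)

lemma height_sign_eq_one: "height_sign g = 1 \<Longrightarrow> g = 0"
  by (cases "even g") (auto simp: height_sign_def)

lemma eps_coeff_potential:
  assumes "even D" "B \<in> phi D" "i \<in> {1..D+1}"
  shows "height_sign (g_count B i) + height_sign (g_count B (succ_pt D i)) =
    (if eps_coeff B i = eps_coeff B (succ_pt D i) then 2 else - 2)"
  using phi_finite[OF assms(2)] assms(3)
proof (rule g_count_step)
  show "I = J" if "I \<in> B" "J \<in> B" "separates D I i" "separates D J i" for I J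
    using phi_separates_unique[OF assms(1,2) that(1,2) assms(3) that(3,4)] .
next
  assume none: "{I \<in> B. separates D I i} = {}" "g_count B (succ_pt D i) = g_count B i"
  \<comment> \<open>Equal counts give twice \<open>height_sign\<close> of the count, which is 2 only
    because the count vanishes on an unseparated edge.\<close>
  then have "i \<notin> \<Union>B" using phi_not_separated[OF assms(2,3)] by blast
  then have "{I \<in> B. i \<in> I} = {}" by blast
  then have "g_count B i = 0" by (simp only: g_count_def card.empty)
  then show ?thesis using none(2) by (simp add: eps_coeff_def height_sign_def)
next
  assume "g_count B (succ_pt D i) = g_count B i + 1 \<or> g_count B i = g_count B (succ_pt D i) + 1"
  then show ?thesis
  proof
    assume "g_count B (succ_pt D i) = g_count B i + 1"
    then show ?thesis using height_sign_step[of "g_count B i"] by (simp add: eps_coeff_def)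
  next
    assume "g_count B i = g_count B (succ_pt D i) + 1"
    then have "height_sign (g_count B (succ_pt D i)) + height_sign (g_count B i) =
        (if eps_coeff B (succ_pt D i) = eps_coeff B i then 2 else - 2)"
      using height_sign_step[of "g_count B (succ_pt D i)"] by (simp add: eps_coeff_def)
    then show ?thesis by (metis add.commute)
  qed
qed

section \<open>Spans and linear relations of a circular basis\<close>

lemma span_coll_subset_sum:
  fixes scale :: "bit \<Rightarrow> 'v::ab_group_add \<Rightarrow> 'v"
  assumes "vector_space scale" "finite B" "v \<in> span_coll scale e B"
  obtains C where "C \<subseteq> B" "v = (\<Sum>I\<in>C. e_set e I)"
proof -
  interpret vector_space scale by fact
  obtain u where u: "v = (\<Sum>w\<in>e_set e ` B. scale (u w) w)"
    using assms(2,3) unfolding span_coll_def by (auto simp: span_finite)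
  define S where "S = {w \<in> e_set e ` B. u w = 1}"
  \<comment> \<open>One member of \<open>B\<close> is chosen for each vector with coefficient 1, so
    the sum reindexes along an injective map.\<close>
  define C where "C = inv_into B (e_set e) ` S"
  have S: "S \<subseteq> e_set e ` B" by (auto simp: S_def)
  have "v = (\<Sum>w\<in>e_set e ` B. if u w = 1 then w else 0)"
    unfolding u by (intro sum.cong) (auto simp: bit_not_one_iff)
  also have "\<dots> = (\<Sum>w\<in>S. w)"
    unfolding S_def using assms(2) by (simp add: sum.If_cases Int_def)
  also have "\<dots> = (\<Sum>w\<in>S. e_set e (inv_into B (e_set e) w))"
    using S by (intro sum.cong) (auto simp: f_inv_into_f)
  also have "\<dots> = (\<Sum>I\<in>C. e_set e I)"
    unfolding C_def using S by (subst sum.reindex) (auto intro: inj_on_inv_into)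
  finally show ?thesis
    using that[of C] S unfolding C_def by (auto intro: inv_into_into)
qed

lemma cong_succ_pt:
  assumes "0 < D" "x \<in> {1..D+1}" "y \<in> {1..D+1}"
  shows "[y = x + 1] (mod (D + 1)) \<longleftrightarrow> y = succ_pt D x"
proof -
  have "z mod (D + 1) = (if z = D + 1 then 0 else z)" if "z \<in> {1..D+1}" for z
    using that by auto
  moreover have "(x + 1) mod (D + 1) = succ_pt D x mod (D + 1)"
    by (simp add: succ_pt_def mod_Suc)
  ultimately show ?thesis
    using assms succ_pt_in[OF assms(2)] by (auto simp: cong_def split: if_splits)
qed

text \<open>Pairing the relation with \<open>e m\<close> keeps only the two neighbours of
  \<open>m\<close>, so weights two steps apart agree; on an odd cycle such steps reach every
  point.\<close>

lemma circular_relation: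
  fixes scale :: "bit \<Rightarrow> 'v::ab_group_add \<Rightarrow> 'v"
  assumes D: "D \<ge> 2" "even D" and "symplectic_space scale form" and circ: "circular_basis D form e"
    and rel: "(\<Sum>i\<in>{1..D+1}. scale (w i) (e i)) = 0"
    and "i \<in> {1..D+1}"
  shows "w (succ_pt D i) = w i"
proof -
  interpret symplectic_space scale form by fact
  have "(\<Sum>i\<in>{1..D+1}. w i * form (e i) (e j)) = 0" for j
  proof -
    interpret l: Vector_Spaces.linear scale "(*)" "\<lambda>x. form x (e j)" by (rule linear_left)
    show ?thesis using arg_cong[OF rel, of "\<lambda>x. form x (e j)"] by (simp only: l.sum l.scale l.zero)
  qed
  note rel' = this
  have skip: "w j = w k"
    if jkm: "j \<in> {1..D+1}" "k \<in> {1..D+1}" "m \<in> {1..D+1}" "succ_pt D j = m" "succ_pt D m = k" for j k m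
  proof -
    have "j \<noteq> k" using that D by (auto simp: succ_pt_def split: if_splits)
    have "form (e x) (e m) = of_bool (x = j \<or> x = k)" if x: "x \<in> {1..D+1}" for x
    proof -
      have "[m = x + 1] (mod (D + 1)) \<longleftrightarrow> x = j"
        using cong_succ_pt[of D x m] D x jkm(1,3,4) by (auto simp: succ_pt_def split: if_splits)
      moreover have "[m + 1 = x] (mod (D + 1)) \<longleftrightarrow> x = k"
        using cong_succ_pt[of D m x] D x jkm(3,5) by (auto simp: cong_sym_eq)
      ultimately show ?thesis using circ x jkm(3) unfolding circular_basis_def by auto
    qed
    then have "(\<Sum>x\<in>{1..D+1}. w x * form (e x) (e m)) = (\<Sum>x\<in>{1..D+1}. if x \<in> {j, k} then w x else 0)"
      by (intro sum.cong) auto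
    also have "\<dots> = (\<Sum>x\<in>{j, k}. w x)"
      using jkm(1,2) by (subst sum.inter_restrict[symmetric]) (auto intro!: sum.cong)
    also have "\<dots> = w j + w k" using \<open>j \<noteq> k\<close> by simp
    finally have "w j + w k = 0" using rel' by metis
    then show ?thesis by (cases "w j"; cases "w k") auto
  qed
  have parity: "w k = (if even k then w 2 else w 1)" if "k \<in> {1..D+1}" for k
    using that
  proof (induction k rule: less_induct)
    case (less k)
    show ?case
    proof (cases "k \<le> 2")
      case True
      then have "k = 1 \<or> k = 2" using less.prems by auto
      then show ?thesis by auto
    next
      case False
      define l where "l = k - 2"
      have l: "k = l + 2" "l \<in> {1..D+1}" "l < k" "l + 1 \<in> {1..D+1}"
        using False less.prems unfolding l_def by auto
      have "w l = w k"
        using l less.prems by (intro skip[of l k "l + 1"]) (auto simp: succ_pt_def)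
      then show ?thesis using less.IH[OF l(3,2)] l(1) by simp
    qed
  qed
  \<comment> \<open>The step across the closing edge links the even points to the odd ones.\<close>
  have "w D = w 1" using D by (intro skip[of D 1 "D + 1"]) (auto simp: succ_pt_def)
  moreover have "w D = w 2" using parity[of D] D by simp
  ultimately have "w k = w 2" if "k \<in> {1..D+1}" for k using parity[OF that] by simp
  then show ?thesis using assms(6) succ_pt_in[OF assms(6)] by metis
qed

section \<open>Comparison of covered points\<close>

lemma span_coll_covers:
  fixes scale :: "bit \<Rightarrow> 'v::ab_group_add \<Rightarrow> 'v"
  assumes D: "D \<ge> 2" "even D" and symp: "symplectic_space scale form"
    and circ: "circular_basis D form e"
    and B': "B' \<in> phi D" and B: "B \<in> phi D"
    and eps: "eps D scale e B' \<in> span_coll scale e B"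
  shows "\<Union>B' \<subseteq> \<Union>B"
proof -
  interpret symplectic_space scale form by fact
  obtain C where C: "C \<subseteq> B" "eps D scale e B' = (\<Sum>I\<in>C. e_set e I)"
    using span_coll_subset_sum[OF vector_space_axioms phi_finite[OF B] eps] .
  have finC: "finite C" using C(1) phi_finite[OF B] finite_subset by blast
  define u :: "nat \<Rightarrow> bit" where "u i = of_nat (g_count C i)" for i
  have "(\<Sum>I\<in>C. e_set e I) = (\<Sum>I\<in>C. \<Sum>i\<in>{1..D+1}. scale (of_bool (i \<in> I)) (e i))"
  proof (intro sum.cong refl)
    fix I assume "I \<in> C"
    then have "I = {i \<in> {1..D+1}. i \<in> I}"
      using odd_interval_subset[OF phi_odd[OF B]] C(1) by blast
    then have "e_set e I = (\<Sum>i | i \<in> {1..D+1} \<and> i \<in> I. e i)" unfolding e_set_def by simp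
    also have "\<dots> = (\<Sum>i\<in>{1..D+1}. if i \<in> I then e i else 0)"
      by (intro sum.inter_filter) simp
    also have "\<dots> = (\<Sum>i\<in>{1..D+1}. scale (of_bool (i \<in> I)) (e i))"
      by (intro sum.cong) auto
    finally show "e_set e I = (\<Sum>i\<in>{1..D+1}. scale (of_bool (i \<in> I)) (e i))" .
  qed
  also have "\<dots> = (\<Sum>i\<in>{1..D+1}. \<Sum>I\<in>C. scale (of_bool (i \<in> I)) (e i))"
    by (rule sum.swap)
  also have "\<dots> = (\<Sum>i\<in>{1..D+1}. scale (u i) (e i))"
  proof (intro sum.cong refl)
    fix i
    have "u i = (\<Sum>I\<in>C. of_bool (i \<in> I))"
      using finC by (simp add: u_def g_count_def sum_of_bool_eq Int_def)
    then show "(\<Sum>I\<in>C. scale (of_bool (i \<in> I)) (e i)) = scale (u i) (e i)"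
      by (simp only: scale_sum_left)
  qed
  finally have "(\<Sum>i\<in>{1..D+1}. scale (eps_coeff B' i - u i) (e i)) = 0"
    using C(2) by (simp only: eps_def scale_left_diff_distrib sum_subtractf diff_self)
  note diff_const = circular_relation[OF D symp circ this]
  have "\<exists>\<beta> :: nat set \<Rightarrow> nat \<Rightarrow> int. \<forall>I\<in>C.
    (\<forall>i\<in>{1..D+1}. \<beta> I i + \<beta> I (succ_pt D i) = - of_bool (separates D I i)) \<and>
    (\<forall>i. i \<notin> I \<longrightarrow> \<beta> I i = 0)"
    using odd_interval_potential phi_odd[OF B] C(1) by (intro bchoice) blast
  then obtain \<beta> :: "nat set \<Rightarrow> nat \<Rightarrow> int"
    where \<beta>: "\<And>I i. I \<in> C \<Longrightarrow> i \<in> {1..D+1} \<Longrightarrow>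
        \<beta> I i + \<beta> I (succ_pt D i) = - of_bool (separates D I i)"
      and \<beta>0: "\<And>I i. I \<in> C \<Longrightarrow> i \<notin> I \<Longrightarrow> \<beta> I i = 0"
    by blast
  \<comment> \<open>The factor 4 turns the edge sum 2 into -2 exactly where one member of
    \<open>C\<close> separates the edge.\<close>
  define M where "M i = 1 + 4 * (\<Sum>I\<in>C. \<beta> I i)" for i
  have M: "height_sign (g_count B' i) + height_sign (g_count B' (succ_pt D i)) = M i + M (succ_pt D i)"
    if i: "i \<in> {1..D+1}" for i
  proof -
    have "(\<Sum>I\<in>C. \<beta> I i) + (\<Sum>I\<in>C. \<beta> I (succ_pt D i)) = (\<Sum>I\<in>C. - of_bool (separates D I i))"
      unfolding sum.distrib[symmetric] using \<beta> i by (intro sum.cong) auto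
    also have "\<dots> = - int (card {I \<in> C. separates D I i})"
      using finC by (simp add: sum_negf sum_of_bool_eq Int_def)
    finally have "M i + M (succ_pt D i) = 2 - 4 * int (card {I \<in> C. separates D I i})"
      unfolding M_def by linarith
    also have "\<dots> = (if u i = u (succ_pt D i) then 2 else - 2)"
      using finC i
    proof (rule g_count_step)
      show "I = J" if "I \<in> C" "J \<in> C" "separates D I i" "separates D J i" for I J
        using phi_separates_unique[OF D(2) B _ _ i that(3,4)] that(1,2) C(1) by blast
    next
      assume "{I \<in> C. separates D I i} = {}" "g_count C (succ_pt D i) = g_count C i"
      then show ?thesis by (simp only: u_def card.empty) simp
    next
      fix I assume "{I \<in> C. separates D I i} = {I}"
        "g_count C (succ_pt D i) = g_count C i + 1 \<or> g_count C i = g_count C (succ_pt D i) + 1"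
      moreover from this(2) have "u i \<noteq> u (succ_pt D i)" unfolding u_def
        by (elim disjE; simp only: of_nat_add add_cancel_left_right add_cancel_right_right) simp_all
      ultimately show ?thesis by simp
    qed
    \<comment> \<open>Coefficients of the same vector differ by a constant, hence change along the
      same edges.\<close>
    also have "u i = u (succ_pt D i) \<longleftrightarrow> eps_coeff B' i = eps_coeff B' (succ_pt D i)"
      using diff_const[OF i] by (metis diff_add_cancel add_diff_cancel_left')
    finally show ?thesis using eps_coeff_potential[OF D(2) B' i] by simp
  qed
  show ?thesis
  proof
    fix i assume "i \<in> \<Union>B'"
    then have i: "i \<in> {1..D+1}" using odd_interval_subset[OF phi_odd[OF B']] by blast
    show "i \<in> \<Union>B"
    proof (rule ccontr)
      assume "i \<notin> \<Union>B"
      then have "M i = 1" using \<beta>0 C(1) unfolding M_def by (simp add: sum.neutral subset_iff)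
      moreover have "height_sign (g_count B' i) - M i = 0"
      proof (rule odd_cycle_zero[OF D(2) _ i])
        show "height_sign (g_count B' j) - M j +
            (height_sign (g_count B' (succ_pt D j)) - M (succ_pt D j)) = 0"
          if "j \<in> {1..D+1}" for j
          using M[OF that] by linarith
      qed
      ultimately have "g_count B' i = 0" using height_sign_eq_one by simp
      then have "{I \<in> B'. i \<in> I} = {}" using phi_finite[OF B'] unfolding g_count_def by simp
      then show False using \<open>i \<in> \<Union>B'\<close> by blast
    qed
  qed
qed

section \<open>Counting separated edges\<close>

lemma card_separated_union:
  assumes "even D" "B \<in> phi D"
  shows "card {i \<in> {1..D+1}. \<exists>I\<in>B. separates D I i} = 2 * card B"
proof -
  have "{i \<in> {1..D+1}. \<exists>I\<in>B. separates D I i} = (\<Union>I\<in>B. {i \<in> {1..D+1}. separates D I i})"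
    by auto
  also have "card \<dots> = (\<Sum>I\<in>B. card {i \<in> {1..D+1}. separates D I i})"
    using phi_separates_unique[OF assms] phi_finite[OF assms(2)]
    by (intro card_UN_disjoint) auto
  also have "\<dots> = (\<Sum>I\<in>B. 2)"
    using card_separated phi_odd[OF assms(2)] by (intro sum.cong) auto
  finally show ?thesis by simp
qed

lemma separated_iff_covered:
  assumes "B \<in> phi D" "i \<in> {1..D+1}"
  shows "(\<exists>I\<in>B. separates D I i) \<longleftrightarrow> i \<in> \<Union>B \<or> succ_pt D i \<in> \<Union>B"
proof
  assume "\<exists>I\<in>B. separates D I i"
  then show "i \<in> \<Union>B \<or> succ_pt D i \<in> \<Union>B" unfolding separates_def by blast
next
  assume "i \<in> \<Union>B \<or> succ_pt D i \<in> \<Union>B"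
  then show "\<exists>I\<in>B. separates D I i" using phi_not_separated[OF assms] by blast
qed

lemma card_mono_of_covers:
  assumes "even D" "B' \<in> phi D" "B \<in> phi D" "\<Union>B' \<subseteq> \<Union>B"
  shows "card B' \<le> card B"
proof -
  have "{i \<in> {1..D+1}. \<exists>I\<in>B'. separates D I i} \<subseteq> {i \<in> {1..D+1}. \<exists>I\<in>B. separates D I i}"
    using separated_iff_covered[OF assms(2)] separated_iff_covered[OF assms(3)] assms(4) by blast
  then have "card {i \<in> {1..D+1}. \<exists>I\<in>B'. separates D I i} \<le> card {i \<in> {1..D+1}. \<exists>I\<in>B. separates D I i}"
    by (intro card_mono) simp_all
  then show ?thesis using card_separated_union[OF assms(1)] assms(2,3) by simp
qed

theorem corollary2p5:
  fixes D :: nat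
    and scale :: "bit \<Rightarrow> 'v::ab_group_add \<Rightarrow> 'v"
    and form :: "'v \<Rightarrow> 'v \<Rightarrow> bit"
    and e :: "nat \<Rightarrow> 'v"
    and A' A :: "nat set set"
  assumes "D \<ge> 2" and "even D"
    and "symplectic_space scale form"
    and "vector_space.dim scale (UNIV :: 'v set) = D"
    and "circular_basis D form e"
    and "A' \<in> phi D" and "A \<in> phi D"
    and "phi_le D scale e A' A"
  shows "card A' \<le> card A"
proof -
  obtain k and Bs :: "nat \<Rightarrow> nat set set"
    where phi: "\<forall>s\<le>k. Bs s \<in> phi D" and ends: "Bs 0 = A'" "Bs k = A"
      and step: "\<forall>s\<in>{1..k}. eps D scale e (Bs (s - 1)) \<in> span_coll scale e (Bs s)"
    using assms(8) unfolding phi_le_def by (elim exE conjE)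
  \<comment> \<open>Inclusion of unions passes along the whole chain, so cardinalities need
    comparing only at its ends.\<close>
  have "\<Union>(Bs 0) \<subseteq> \<Union>(Bs s)" if "s \<le> k" for s
    using that
  proof (induction s)
    case (Suc s)
    then have "\<Union>(Bs s) \<subseteq> \<Union>(Bs (Suc s))"
      using span_coll_covers[OF assms(1-3,5), of "Bs s" "Bs (Suc s)"] phi
        bspec[OF step, of "Suc s"] by simp
    then show ?case using Suc by simp
  qed simp
  then show ?thesis
    using card_mono_of_covers[OF assms(2,6,7)] ends by blast
qed

end
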